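(* Let $\theta=\{\theta_k\}_{k\in\mathbb Z}$ belong to $\mathcal S(p,\omega)$ for some $p\in\mathbb N$ and $\omega>0$, and suppose that $\phi\in\mathcal{BPC}(\theta)$ is an asymptotically unpredictable function with values in $\mathbb R^m$. Then, for every real number $c$, the function $\widetilde\phi:\mathbb R\to\mathbb R^m$ defined by $\widetilde\phi(t)=\phi(t+c)$ is also asymptotically unpredictable.
   Context: Vectors carry the Euclidean norm. $\mathcal S(p,\omega)$ is the set of strictly increasing real sequences $\theta=\{\theta_k\}_{k\in\mathbb Z}$ with $\theta_{k+p}=\theta_k+\omega$ for all $k\in\mathbb Z$ ($p\in\mathbb N$, $\omega>0$). $\mathcal{BPC}(\theta)$ is the set of bounded functions $\varphi:\mathbb R\to\mathbb R^m$ such that for each $k\in\mathbb Z$: $\varphi$ is continuous on $(\theta_{k-1},\theta_k)$, the right limit $\varphi(\theta_k+)=\lim_{t\to\theta_k^+}\varphi(t)$ exists, and $\varphi(\theta_k)=\lim_{t\to\theta_k^-}\varphi(t)$. Unpredictable function: $\psi\in\mathcal{BPC}(\theta)$, with $\theta\in\mathcal S(p,\omega)$, is unpredictable if there exist positive numbers $\varepsilon_0,\nu$ and real sequences $\{\mu_n\}_{n\in\mathbb N}$, $\{\tau_n\}_{n\in\mathbb N}$, both diverging to infinity, such that (i) for every $\varepsilon>0$ there is $\delta>0$ with $\|\psi(s_1)-\psi(s_2)\|<\varepsilon$ whenever $s_1,s_2$ belong to the same interval of continuity (one of the intervals determined by consecutive $\theta_{k-1},\theta_k$) and $|s_1-s_2|<\delta$;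 (ii) $\|\psi(t+\mu_n)-\psi(t)\|\to0$ as $n\to\infty$ uniformly on compact subsets of $\mathbb R$; (iii) $\|\psi(t+\mu_n)-\psi(t)\|\ge\varepsilon_0$ for each $t\in[\tau_n-\nu,\tau_n+\nu]$ and $n\in\mathbb N$. Asymptotically unpredictable function: $\phi\in\mathcal{BPC}(\theta)$, with $\theta\in\mathcal S(p,\omega)$, is asymptotically unpredictable if $\phi(t)=\psi(t)+\xi(t)$ for all $t\in\mathbb R$, for some unpredictable $\psi\in\mathcal{BPC}(\theta)$ and some $\xi\in\mathcal{BPC}(\theta)$ with $\|\xi(t)\|\to0$ as $t\to\infty$. A function $\mathbb R\to\mathbb R^m$ given without a specified $\theta$ is called asymptotically unpredictable if this holds for some sequence in $\mathcal S(p,\omega)$ for some $p\in\mathbb N$, $\omega>0$ (not necessarily the sequence associated with another function in the statement). *)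

theory Defs
  imports "HOL-Analysis.Analysis"
begin

definition S_seq :: "nat \<Rightarrow> real \<Rightarrow> (int \<Rightarrow> real) set" where
  "S_seq p \<omega> =
    {\<theta>. 0 < p \<and> 0 < \<omega> \<and> strict_mono \<theta> \<and> (\<forall>k. \<theta> (k + int p) = \<theta> k + \<omega>)}"

definition BPC :: "(int \<Rightarrow> real) \<Rightarrow> (real \<Rightarrow> real ^ 'm) set" where
  "BPC \<theta> =
    {\<phi>. bounded (range \<phi>) \<and>
        (\<forall>k. continuous_on {\<theta> (k - 1)<..<\<theta> k} \<phi> \<and>
             (\<exists>L. (\<phi> \<longlongrightarrow> L) (at_right (\<theta> k))) \<and>
             (\<phi> \<longlongrightarrow> \<phi> (\<theta> k)) (at_left (\<theta> k)))}"

text \<open>Functions in \<^term>\<open>BPC \<theta>\<close> are continuous from the left at each \<open>\<theta> k\<close>, so the intervals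
  of continuity are taken to be \<open>{\<theta> (k - 1)<..\<theta> k}\<close>, which partition the real line. Condition (i)
  is the same with the open intervals, by left continuity.\<close>

definition unpredictable_wrt :: "(int \<Rightarrow> real) \<Rightarrow> (real \<Rightarrow> real ^ 'm) \<Rightarrow> bool" where
  "unpredictable_wrt \<theta> \<psi> \<longleftrightarrow>
    (\<exists>p \<omega>. \<theta> \<in> S_seq p \<omega>) \<and> \<psi> \<in> BPC \<theta> \<and>
    (\<exists>\<epsilon>\<^sub>0 > 0. \<exists>\<nu> > 0. \<exists>\<mu> \<tau> :: nat \<Rightarrow> real.
        filterlim \<mu> at_top sequentially \<and> filterlim \<tau> at_top sequentially \<and>
        (\<forall>\<epsilon> > 0. \<exists>\<delta> > 0. \<forall>k. \<forall>s\<^sub>1 \<in> {\<theta> (k - 1)<..\<theta> k}. \<forall>s\<^sub>2 \<in> {\<theta> (k - 1)<..\<theta> k}.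
            \<bar>s\<^sub>1 - s\<^sub>2\<bar> < \<delta> \<longrightarrow> norm (\<psi> s\<^sub>1 - \<psi> s\<^sub>2) < \<epsilon>) \<and>
        (\<forall>K. compact K \<longrightarrow>
            uniform_limit K (\<lambda>n t. norm (\<psi> (t + \<mu> n) - \<psi> t)) (\<lambda>t. 0) sequentially) \<and>
        (\<forall>n. \<forall>t \<in> {\<tau> n - \<nu>..\<tau> n + \<nu>}. norm (\<psi> (t + \<mu> n) - \<psi> t) \<ge> \<epsilon>\<^sub>0))"

definition asymptotically_unpredictable_wrt ::
    "(int \<Rightarrow> real) \<Rightarrow> (real \<Rightarrow> real ^ 'm) \<Rightarrow> bool" where
  "asymptotically_unpredictable_wrt \<theta> \<phi> \<longleftrightarrow>
    (\<exists>p \<omega>. \<theta> \<in> S_seq p \<omega>) \<and> \<phi> \<in> BPC \<theta> \<and>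
    (\<exists>\<psi> \<xi>. unpredictable_wrt \<theta> \<psi> \<and> \<xi> \<in> BPC \<theta> \<and>
        ((\<lambda>t. norm (\<xi> t)) \<longlongrightarrow> 0) at_top \<and> (\<forall>t. \<phi> t = \<psi> t + \<xi> t))"

definition asymptotically_unpredictable :: "(real \<Rightarrow> real ^ 'm) \<Rightarrow> bool" where
  "asymptotically_unpredictable \<phi> \<longleftrightarrow> (\<exists>\<theta>. asymptotically_unpredictable_wrt \<theta> \<phi>)"

end

theory Submission imports Defs begin

text \<open>Every ingredient of the definition is translation covariant. If \<phi> = \<psi> + \<xi>
  with discontinuities allowed at the points \<open>\<theta> k\<close>, then the translates of
  \<psi> and \<xi> by c add up to the translate of \<phi>, and their discontinuities can lie only at
  the points \<open>\<theta> k - c\<close>. The new sequence has the same p and \<omega>, because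
  subtracting a constant preserves order and increments. The translate of \<xi> still decays at
  infinity. The main work is in \<open>unpredictable_wrt_shift\<close>: the translate of \<psi> is
  unpredictable with the same \<epsilon>0, \<nu> and \<mu>, and with \<tau> moved by -c. Membership
  in \<open>BPC\<close> is transferred by \<open>BPC_shift\<close>.\<close>

lemma S_seq_shift:
  assumes "\<theta> \<in> S_seq p \<omega>"
  shows "(\<lambda>k. \<theta> k - c) \<in> S_seq p \<omega>"
  using assms by (auto simp: S_seq_def strict_mono_def)

lemma BPC_shift:
  fixes f :: "real \<Rightarrow> real ^ 'm"
  assumes "f \<in> BPC \<theta>"
  shows "(\<lambda>t. f (t + c)) \<in> BPC (\<lambda>k. \<theta> k - c)"
proof -
  have bdd: "bounded (range f)"
    and cont: "\<And>k. continuous_on {\<theta> (k - 1)<..<\<theta> k} f"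
    and right: "\<And>k. \<exists>L. (f \<longlongrightarrow> L) (at_right (\<theta> k))"
    and left: "\<And>k. (f \<longlongrightarrow> f (\<theta> k)) (at_left (\<theta> k))"
    using assms by (auto simp: BPC_def)
  have "bounded (range (\<lambda>t. f (t + c)))"
    by (rule bounded_subset[OF bdd]) auto
  moreover have "continuous_on {\<theta> (k - 1) - c<..<\<theta> k - c} (\<lambda>t. f (t + c))" for k
    by (rule continuous_on_compose2[OF cont[of k]]) (auto intro!: continuous_intros)
  \<comment> \<open>The one-sided neighbourhood filter at \<open>\<theta> k - c\<close> is the image
    of the one at \<open>\<theta> k\<close> under subtraction of c; composing with this map turns
    \<open>f (t + c)\<close> back into f.\<close>
  moreover have "\<exists>L. ((\<lambda>t. f (t + c)) \<longlongrightarrow> L) (at_right (\<theta> k - c))" for k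
    using right[of k]
    by (simp add: filtermap_at_right_shift[of c "\<theta> k", symmetric] filterlim_filtermap)
  moreover have "((\<lambda>t. f (t + c)) \<longlongrightarrow> f (\<theta> k - c + c)) (at_left (\<theta> k - c))" for k
    using left[of k]
    by (simp add: filtermap_at_left_shift[of c "\<theta> k", symmetric] filterlim_filtermap)
  ultimately show ?thesis
    by (simp add: BPC_def)
qed

text \<open>The increment of the translate at t over \<open>\<mu> n\<close> is the increment of
  \<psi> at \<open>t + c\<close> over the same \<open>\<mu> n\<close>. Hence \<mu> and both
  constants survive, and only the centres of the separation windows move.\<close>

lemma unpredictable_wrt_shift:
  fixes \<psi> :: "real \<Rightarrow> real ^ 'm"
  assumes "unpredictable_wrt \<theta> \<psi>"
  shows "unpredictable_wrt (\<lambda>k. \<theta> k - c) (\<lambda>t. \<psi> (t + c))"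
proof -
  from assms obtain p \<omega> \<epsilon>\<^sub>0 \<nu> and \<mu> \<tau> :: "nat \<Rightarrow> real" where
      \<theta>: "\<theta> \<in> S_seq p \<omega>" and \<psi>: "\<psi> \<in> BPC \<theta>" and pos: "\<epsilon>\<^sub>0 > 0" "\<nu> > 0"
    and \<mu>: "filterlim \<mu> at_top sequentially" and \<tau>: "filterlim \<tau> at_top sequentially"
    and uc: "\<forall>\<epsilon> > 0. \<exists>\<delta> > 0. \<forall>k. \<forall>s\<^sub>1 \<in> {\<theta> (k - 1)<..\<theta> k}.
        \<forall>s\<^sub>2 \<in> {\<theta> (k - 1)<..\<theta> k}. \<bar>s\<^sub>1 - s\<^sub>2\<bar> < \<delta> \<longrightarrow> norm (\<psi> s\<^sub>1 - \<psi> s\<^sub>2) < \<epsilon>"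
    and ul: "\<forall>K. compact K \<longrightarrow>
        uniform_limit K (\<lambda>n t. norm (\<psi> (t + \<mu> n) - \<psi> t)) (\<lambda>t. 0) sequentially"
    and sep: "\<forall>n. \<forall>t \<in> {\<tau> n - \<nu>..\<tau> n + \<nu>}. norm (\<psi> (t + \<mu> n) - \<psi> t) \<ge> \<epsilon>\<^sub>0"
    unfolding unpredictable_wrt_def by (elim conjE exE) (rule that; assumption)
  have \<tau>': "filterlim (\<lambda>n. \<tau> n - c) at_top sequentially"
    using filterlim_tendsto_add_at_top[OF tendsto_const[of "- c"] \<tau>] by simp
  have uc': "\<exists>\<delta> > 0. \<forall>k. \<forall>s\<^sub>1 \<in> {\<theta> (k - 1) - c<..\<theta> k - c}.
      \<forall>s\<^sub>2 \<in> {\<theta> (k - 1) - c<..\<theta> k - c}.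
        \<bar>s\<^sub>1 - s\<^sub>2\<bar> < \<delta> \<longrightarrow> norm (\<psi> (s\<^sub>1 + c) - \<psi> (s\<^sub>2 + c)) < \<epsilon>" if "\<epsilon> > 0" for \<epsilon>
  proof -
    \<comment> \<open>The modulus of \<psi> serves unchanged, since adding c to both points keeps
      their distance and sends each shifted interval of continuity onto the original one.\<close>
    obtain \<delta> where "\<delta> > 0" and \<delta>: "\<And>k s\<^sub>1 s\<^sub>2. \<lbrakk>s\<^sub>1 \<in> {\<theta> (k - 1)<..\<theta> k}; s\<^sub>2 \<in> {\<theta> (k - 1)<..\<theta> k};
        \<bar>s\<^sub>1 - s\<^sub>2\<bar> < \<delta>\<rbrakk> \<Longrightarrow> norm (\<psi> s\<^sub>1 - \<psi> s\<^sub>2) < \<epsilon>"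
      using uc[rule_format, OF \<open>\<epsilon> > 0\<close>] by metis
    show ?thesis
    proof (intro exI[of _ \<delta>] conjI allI ballI impI \<open>\<delta> > 0\<close>)
      fix k s\<^sub>1 s\<^sub>2
      assume "s\<^sub>1 \<in> {\<theta> (k - 1) - c<..\<theta> k - c}" "s\<^sub>2 \<in> {\<theta> (k - 1) - c<..\<theta> k - c}" "\<bar>s\<^sub>1 - s\<^sub>2\<bar> < \<delta>"
      then show "norm (\<psi> (s\<^sub>1 + c) - \<psi> (s\<^sub>2 + c)) < \<epsilon>"
        by (intro \<delta>[of _ k]) auto
    qed
  qed
  have ul': "uniform_limit K (\<lambda>n t. norm (\<psi> (t + \<mu> n + c) - \<psi> (t + c))) (\<lambda>t. 0) sequentially"
    if "compact K" for K
  proof -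
    \<comment> \<open>Convergence on K for the translate is convergence on the compact set K + c for
      \<psi>, pulled back along t \<mapsto> t + c.\<close>
    have "compact ((\<lambda>t. t + c) ` K)"
      by (intro compact_continuous_image that continuous_intros)
    then have "uniform_limit K (\<lambda>n t. norm (\<psi> (t + c + \<mu> n) - \<psi> (t + c))) (\<lambda>t. 0) sequentially"
      by (intro uniform_limit_compose'[OF ul[rule_format]]) auto
    then show ?thesis
      by (simp add: add_ac)
  qed
  have sep': "norm (\<psi> (t + \<mu> n + c) - \<psi> (t + c)) \<ge> \<epsilon>\<^sub>0"
    if "t \<in> {\<tau> n - c - \<nu>..\<tau> n - c + \<nu>}" for n t
    \<comment> \<open>If t lies within \<nu> of \<open>\<tau> n - c\<close>, then
      \<open>t + c\<close> lies within \<nu> of \<open>\<tau> n\<close>.\<close>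
    using sep[rule_format, of "t + c" n] that by (simp add: algebra_simps)
  show ?thesis
    unfolding unpredictable_wrt_def
  proof (intro conjI)
    show "\<exists>p \<omega>. (\<lambda>k. \<theta> k - c) \<in> S_seq p \<omega>"
      using S_seq_shift[OF \<theta>] by blast
    show "(\<lambda>t. \<psi> (t + c)) \<in> BPC (\<lambda>k. \<theta> k - c)"
      by (rule BPC_shift[OF \<psi>])
  qed (intro exI[of _ \<epsilon>\<^sub>0] exI[of _ \<nu>] exI[of _ \<mu>] exI[of _ "\<lambda>n. \<tau> n - c"]
      conjI pos \<mu> \<tau>' allI impI ballI uc' ul' sep')
qed

theorem lemma2p3:
  fixes p :: nat and \<omega> :: real and \<theta> :: "int \<Rightarrow> real" and \<phi> :: "real \<Rightarrow> real ^ 'm" and c :: real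
  assumes "\<theta> \<in> S_seq p \<omega>"
    and "\<phi> \<in> BPC \<theta>"
    and "asymptotically_unpredictable_wrt \<theta> \<phi>"
  shows "asymptotically_unpredictable (\<lambda>t. \<phi> (t + c))"
proof -
  from assms(3) obtain \<psi> \<xi> where \<psi>: "unpredictable_wrt \<theta> \<psi>" and \<xi>: "\<xi> \<in> BPC \<theta>"
    and lim: "((\<lambda>t. norm (\<xi> t)) \<longlongrightarrow> 0) at_top" and sum: "\<And>t. \<phi> t = \<psi> t + \<xi> t"
    unfolding asymptotically_unpredictable_wrt_def by blast
  \<comment> \<open>Decay of \<xi> at infinity passes to its translate because t + c tends to
    infinity with t, whatever the sign of c.\<close>
  have "filterlim (\<lambda>t. t + c) at_top at_top"
    using filterlim_tendsto_add_at_top[OF tendsto_const[of c] filterlim_ident]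
    by (simp add: add.commute)
  then have "((\<lambda>t. norm (\<xi> (t + c))) \<longlongrightarrow> 0) at_top"
    by (rule filterlim_compose[OF lim])
  then have "asymptotically_unpredictable_wrt (\<lambda>k. \<theta> k - c) (\<lambda>t. \<phi> (t + c))"
    unfolding asymptotically_unpredictable_wrt_def
    by (intro conjI exI[of _ p] exI[of _ \<omega>] exI[of _ "\<lambda>t. \<psi> (t + c)"] exI[of _ "\<lambda>t. \<xi> (t + c)"]
        allI S_seq_shift[OF assms(1)] BPC_shift[OF assms(2)] BPC_shift[OF \<xi>]
        unpredictable_wrt_shift[OF \<psi>] sum)
  then show ?thesis
    unfolding asymptotically_unpredictable_def by blast
qed

end
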